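(* Let $|\psi\rangle=c_1|00\rangle+c_2|01\rangle+c_3|10\rangle+c_4|11\rangle$ be a Haar-random pure two-qubit state, and let $$P_{\psi^{\otimes4}\to\phi^+}=2\left|c_2^4c_3^4\right|+2\left|c_1^4c_4^4\right|-4\,\mathrm{Re}\left[c_1^2c_4^2(c_2^* )^2(c_3^* )^2\right].$$ Then the average of $P_{\psi^{\otimes4}\to\phi^+}$ over the Haar measure is $$\langle P_{\psi^{\otimes4}\to\phi^+}\rangle=\frac{2}{105}.$$
   Context: Haar-random means that $(c_1,c_2,c_3,c_4)$ is distributed according to the unitarily invariant probability measure on the unit sphere of $\mathbb{C}^4$. The quantity $P_{\psi^{\otimes4}\to\phi^+}$ is the optimal success probability of obtaining the Bell state $|\phi^+\rangle=(|00\rangle+|11\rangle)/\sqrt2$ from four copies of $|\psi\rangle$ by a universal conclusive entanglement concentration protocol based on concatenated two-qubit operations. *)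

theory Defs
  imports "HOL-Probability.Probability"
begin

definition conj_transpose :: "complex^'n^'m \<Rightarrow> complex^'m^'n" where
  "conj_transpose A = (\<chi> i j. cnj (A $ j $ i))"

definition unitary_matrix :: "complex^'n^'n \<Rightarrow> bool" where
  "unitary_matrix U \<longleftrightarrow> conj_transpose U ** U = mat 1 \<and> U ** conj_transpose U = mat 1"

abbreviation sphere_borel :: "(complex^'n) measure" where
  "sphere_borel \<equiv> restrict_space borel (sphere 0 1)"

definition haar_sphere :: "(complex^'n) measure \<Rightarrow> bool" where
  "haar_sphere \<mu> \<longleftrightarrow> prob_space \<mu> \<and> sets \<mu> = sets sphere_borel \<and>
     (\<forall>U. unitary_matrix U \<longrightarrow> distr \<mu> \<mu> (\<lambda>c. U *v c) = \<mu>)"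

text \<open>The vector \<open>c\<close> collects the amplitudes of
  \<open>c\<^sub>1|00> + c\<^sub>2|01> + c\<^sub>3|10> + c\<^sub>4|11>\<close>; in the index type \<open>4\<close>, the numeral 4 denotes
  the same element as 0 and differs from 1, 2 and 3.
  The value is the closed form of the optimal probability of obtaining a Bell state from four
  copies of the state by concatenated two-qubit operations.\<close>

definition success_prob :: "complex^4 \<Rightarrow> real" where
  "success_prob c =
     2 * cmod ((c$2)^4 * (c$3)^4) + 2 * cmod ((c$1)^4 * (c$4)^4)
     - 4 * Re ((c$1)^2 * (c$4)^2 * (cnj (c$2))^2 * (cnj (c$3))^2)"

text \<open>The predicate \<^const>\<open>haar_sphere\<close> is satisfiable on \<open>complex^4\<close>: radially project the uniform
  distribution on the unit ball of \<open>real^8\<close>.\<close>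

lemma norm_unitary:
  fixes U :: "complex^'n^'n"
  assumes "unitary_matrix U"
  shows "norm (U *v c) = norm c"
proof -
  have ip: "complex_of_real ((norm x)\<^sup>2) = (\<Sum>i\<in>UNIV. cnj (x$i) * (x$i))" for x :: "complex^'n"
  proof -
    have "(norm x)\<^sup>2 = (\<Sum>i\<in>UNIV. (norm (x$i))\<^sup>2)"
      unfolding norm_vec_def L2_set_def by (rule real_sqrt_pow2) (simp add: sum_nonneg)
    moreover have "complex_of_real ((norm z)\<^sup>2) = cnj z * z" for z
      by (metis complex_norm_square mult.commute)
    ultimately show ?thesis by (simp only: of_real_sum)
  qed
  have "(\<Sum>i\<in>UNIV. cnj ((U *v c)$i) * ((U *v c)$i))
      = (\<Sum>i\<in>UNIV. \<Sum>j\<in>UNIV. \<Sum>k\<in>UNIV. cnj (c$j) * (cnj (U$i$j) * U$i$k) * c$k)"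
    by (simp add: matrix_vector_mult_def sum_product) (simp add: mult_ac)
  also have "\<dots> = (\<Sum>j\<in>UNIV. \<Sum>i\<in>UNIV. \<Sum>k\<in>UNIV. cnj (c$j) * (cnj (U$i$j) * U$i$k) * c$k)"
    by (rule sum.swap)
  also have "\<dots> = (\<Sum>j\<in>UNIV. \<Sum>k\<in>UNIV. \<Sum>i\<in>UNIV. cnj (c$j) * (cnj (U$i$j) * U$i$k) * c$k)"
    by (intro sum.cong refl sum.swap)
  also have "\<dots> = (\<Sum>j\<in>UNIV. \<Sum>k\<in>UNIV. cnj (c$j) * (conj_transpose U ** U)$j$k * c$k)"
    by (simp add: matrix_matrix_mult_def conj_transpose_def sum_distrib_left sum_distrib_right)
  also have "\<dots> = (\<Sum>j\<in>UNIV. cnj (c$j) * c$j)"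
    using assms by (simp add: unitary_matrix_def mat_def if_distrib[of "\<lambda>x. _ * x"]
        if_distrib[of "\<lambda>x. x * _"] cong: if_cong)
  finally have "(norm (U *v c))\<^sup>2 = (norm c)\<^sup>2"
    unfolding ip[symmetric] of_real_eq_iff .
  then show ?thesis by simp
qed

lemma distr_uniform_ball_orthogonal:
  fixes V :: "real^'n::{finite,wellorder} \<Rightarrow> real^'n::{finite,wellorder}"
  assumes V: "orthogonal_transformation V"
  defines "\<nu> \<equiv> uniform_measure lborel (ball 0 1)"
  shows "distr \<nu> borel V = \<nu>"
proof (rule measure_eqI)
  have Vm: "V \<in> borel_measurable borel"
    by (intro borel_measurable_continuous_onI linear_continuous_on linear_conv_bounded_linear[THEN iffD1]
        orthogonal_transformation_linear V)
  fix A assume "A \<in> sets (distr \<nu> borel V)"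
  then have A: "A \<in> sets borel" by simp
  have VA: "V -` A \<in> sets borel"
    using measurable_sets[OF Vm A] by simp
  have bij: "bij V" by (rule orthogonal_transformation_bij[OF V])
  have eq: "ball 0 1 \<inter> A = V ` (ball 0 1 \<inter> V -` A)"
  proof -
    have "V ` (ball 0 1 \<inter> V -` A) = V ` ball 0 1 \<inter> A" by blast
    moreover have "V ` ball 0 1 = ball (V 0) 1"
      by (rule image_orthogonal_transformation_ball[OF V])
    moreover have "V 0 = 0"
      using V by (simp add: linear_0 orthogonal_transformation_linear)
    ultimately show ?thesis by simp
  qed
  have fin: "ball 0 1 \<inter> B \<in> lmeasurable" if "B \<in> sets borel" for B :: "(real^'n::{finite,wellorder}) set"
    by (rule bounded_set_imp_lmeasurable) (use that in \<open>auto intro: bounded_Int\<close>)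
  have em: "emeasure lborel (ball 0 1 \<inter> B) = ennreal (measure lebesgue (ball 0 1 \<inter> B))"
    if "B \<in> sets borel" for B :: "(real^'n::{finite,wellorder}) set"
    using emeasure_eq_measure2[OF fin[OF that]] that by simp
  have "emeasure lborel (ball 0 1 \<inter> V -` A) = emeasure lborel (ball 0 1 \<inter> A)"
    unfolding em[OF A] em[OF VA] unfolding eq
    by (simp add: measure_orthogonal_image[OF V fin[OF VA]])
  then show "emeasure (distr \<nu> borel V) A = emeasure \<nu> A"
    using A VA Vm by (simp add: \<nu>_def emeasure_distr)
qed (simp add: \<nu>_def)

lemma haar_sphere_exists: "\<exists>\<mu> :: (complex^4) measure. haar_sphere \<mu>"
proof -
  have "card (UNIV :: (4 \<times> bool) set) = card (UNIV :: 8 set)"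
    by (simp add: card_cartesian_product flip: UNIV_Times_UNIV)
  then obtain b :: "4 \<times> bool \<Rightarrow> 8" where b: "bij b"
    using bij_betw_iff_card[of "UNIV :: (4 \<times> bool) set" "UNIV :: 8 set"] by auto
  define g :: "real^8 \<Rightarrow> complex^4"
    where "g x = (\<chi> i. Complex (x $ b (i,False)) (x $ b (i,True)))" for x
  define k :: "complex^4 \<Rightarrow> real^8"
    where "k c = (\<chi> j. case inv b j of (i,t) \<Rightarrow> if t then Im (c$i) else Re (c$i))" for c
  have gk: "g (k c) = c" for c
    using bij_is_inj[OF b] by (simp add: g_def k_def vec_eq_iff inv_f_f)
  have lg: "linear g"
    by (intro linearI) (auto simp: g_def vec_eq_iff complex_eq_iff)
  have lk: "linear k"
    by (intro linearI) (auto simp: k_def vec_eq_iff split: prod.split)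
  have ng: "norm (g x) = norm x" for x
  proof -
    have "(\<Sum>j\<in>UNIV. (x$j)\<^sup>2) = (\<Sum>p\<in>UNIV. (x $ b p)\<^sup>2)"
      using sum.reindex_bij_betw[OF b, of "\<lambda>j. (x$j)\<^sup>2"] by simp
    also have "\<dots> = (\<Sum>i\<in>UNIV. \<Sum>t\<in>UNIV. (x $ b (i,t))\<^sup>2)"
      by (simp add: sum.cartesian_product flip: UNIV_Times_UNIV)
    also have "\<dots> = (\<Sum>i\<in>UNIV. (norm (g x $ i))\<^sup>2)"
      by (simp add: g_def UNIV_bool cmod_power2 add.commute)
    finally show ?thesis
      by (simp add: norm_vec_def L2_set_def)
  qed
  have nk: "norm (k c) = norm c" for c
    using ng[of "k c"] by (simp add: gk)
  have kg: "k (g x) = x" for x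
  proof -
    have "norm (k (g x) - x) = norm (g (k (g x) - x))" by (simp add: ng)
    also have "\<dots> = 0" by (simp add: linear_diff[OF lg] gk)
    finally show ?thesis by simp
  qed
  define \<nu> where "\<nu> = uniform_measure lborel (ball 0 1 :: (real^8) set)"
  have ball: "emeasure lborel (ball 0 1 :: (real^8) set) \<noteq> 0"
    "emeasure lborel (ball 0 1 :: (real^8) set) \<noteq> \<infinity>"
    using emeasure_lborel_ball_finite[of "0::real^8" 1] content_ball_pos[of 1 "0::real^8"]
    by (auto simp: measure_def)
  interpret \<nu>: prob_space \<nu>
    unfolding \<nu>_def using ball by (rule prob_space_uniform_measure)
  have sets_\<nu>: "sets \<nu> = sets borel" by (simp add: \<nu>_def)
  define h :: "real^8 \<Rightarrow> complex^4"
    where "h x = (if x = 0 then axis 1 1 else g (x /\<^sub>R norm x))" for x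
  have h_sphere: "h x \<in> sphere 0 1" for x
    by (simp add: h_def ng)
  have gm: "g \<in> borel_measurable borel"
    by (intro borel_measurable_continuous_onI linear_continuous_on linear_conv_bounded_linear[THEN iffD1] lg)
  have "h \<in> borel_measurable borel"
    unfolding h_def using gm by measurable
  then have hm: "h \<in> borel \<rightarrow>\<^sub>M sphere_borel"
    using h_sphere by (intro measurable_restrict_space2) auto
  define \<mu> where "\<mu> = distr \<nu> sphere_borel h"
  have hm': "h \<in> \<nu> \<rightarrow>\<^sub>M sphere_borel"
    using hm by (simp add: measurable_cong_sets[OF sets_\<nu> refl])
  have "distr \<mu> \<mu> (\<lambda>c. U *v c) = \<mu>" if U: "unitary_matrix U" for U
  proof -
    define V where "V x = k (U *v g x)" for x
    have lU: "linear ((*v) U)"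
      by (rule linearI) (simp_all add: matrix_vector_right_distrib, simp add: matrix_vector_mult_def vec_eq_iff scaleR_sum_right)
    have lV: "linear V"
      using linear_compose[OF linear_compose[OF lg lU] lk] by (simp add: V_def[abs_def] o_def)
    have nV: "norm (V x) = norm x" for x
      by (simp add: V_def nk ng norm_unitary[OF U])
    have oV: "orthogonal_transformation V"
      using lV nV by (simp add: orthogonal_transformation)
    have Vm: "V \<in> borel_measurable borel"
      by (intro borel_measurable_continuous_onI linear_continuous_on linear_conv_bounded_linear[THEN iffD1] lV)
    have "(\<lambda>c. U *v c) \<in> borel_measurable borel"
      by (intro borel_measurable_continuous_onI linear_continuous_on linear_conv_bounded_linear[THEN iffD1] lU)
    then have Um: "(\<lambda>c. U *v c) \<in> sphere_borel \<rightarrow>\<^sub>M sphere_borel"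
      by (intro measurable_restrict_space2 measurable_restrict_space1)
        (auto simp: space_restrict_space norm_unitary[OF U])
    have "distr \<mu> \<mu> (\<lambda>c. U *v c) = distr \<mu> sphere_borel (\<lambda>c. U *v c)"
      by (rule distr_cong) (auto simp: \<mu>_def)
    also have "\<dots> = distr \<nu> sphere_borel ((\<lambda>c. U *v c) \<circ> h)"
      unfolding \<mu>_def by (rule distr_distr[OF Um hm'])
    also have "\<dots> = distr \<nu> sphere_borel (h \<circ> V)"
    proof (rule distr_cong_AE[OF refl refl])
      have "h (V x) = U *v h x" if "x \<noteq> 0" for x
      proof -
        have "V x \<noteq> 0" using that nV[of x] by auto
        then have "h (V x) = g (V x) /\<^sub>R norm x"
          by (simp add: h_def nV linear_scale[OF lg])
        also have "\<dots> = (U *v g x) /\<^sub>R norm x"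
          by (simp only: V_def gk)
        also have "\<dots> = U *v h x"
          using that by (simp only: h_def if_False linear_scale[OF lg] linear_scale[OF lU])
        finally show ?thesis .
      qed
      then have "x \<in> ball 0 1 \<longrightarrow> ((\<lambda>c. U *v c) \<circ> h) x = (h \<circ> V) x" if "x \<noteq> 0" for x
        using that by simp
      then have "AE x in lborel. x \<in> ball 0 1 \<longrightarrow> ((\<lambda>c. U *v c) \<circ> h) x = (h \<circ> V) x"
        by (rule eventually_mono[OF AE_lborel_singleton[of 0]])
      then show "AE x in \<nu>. ((\<lambda>c. U *v c) \<circ> h) x = (h \<circ> V) x"
        unfolding \<nu>_def by (intro AE_uniform_measureI) simp_all
      show "(\<lambda>c. U *v c) \<circ> h \<in> \<nu> \<rightarrow>\<^sub>M sphere_borel"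
        by (rule measurable_comp[OF hm' Um])
      show "h \<circ> V \<in> \<nu> \<rightarrow>\<^sub>M sphere_borel"
        using measurable_comp[OF Vm hm] by (simp add: measurable_cong_sets[OF sets_\<nu> refl])
    qed
    also have "\<dots> = distr (distr \<nu> borel V) sphere_borel h"
      by (rule distr_distr[symmetric, OF hm]) (use Vm in \<open>simp add: measurable_cong_sets[OF sets_\<nu> refl]\<close>)
    also have "\<dots> = \<mu>"
      unfolding \<mu>_def \<nu>_def distr_uniform_ball_orthogonal[OF oV] ..
    finally show ?thesis .
  qed
  moreover have "prob_space \<mu>"
    unfolding \<mu>_def by (rule \<nu>.prob_space_distr[OF hm'])
  ultimately have "haar_sphere \<mu>"
    by (simp add: haar_sphere_def \<mu>_def)
  then show ?thesis ..
qed

end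

(* Write x k = |c k|^2. Mixing two coordinates by the unitaries with rows (1,w)/sqrt 2 and (1,-w)/sqrt 2
   and averaging over the fourth roots of unity w gives E[(x i)^2 f] = 2 E[x i x j f] for every f that
   does not depend on the coordinates i and j. Together with the sum of the x k being 1, this determines
   all the required moments as multiples of e = E[x 1 x 2 x 3 x 4]: products of three, two and one
   distinct x k have mean 7e, 42e and 210e, so that 840e = 1. The interference term changes sign under
   the substitution c 1 -> i c 1, so its mean vanishes. *)

theory Submission
  imports Defs
begin

section \<open>Unitaries acting on two coordinates\<close>

text \<open>One shape serves both for the balanced mixing of two coordinates and for the phase
  change of a single one.\<close>

definition block_unitary ::
  "'n \<Rightarrow> 'n \<Rightarrow> complex \<Rightarrow> complex \<Rightarrow> complex \<Rightarrow> complex \<Rightarrow> complex^'n^'n" where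
  "block_unitary i j a b c d = (\<chi> p q.
     if p = i then (if q = i then a else if q = j then b else 0)
     else if p = j then (if q = i then c else if q = j then d else 0)
     else if p = q then 1 else 0)"

lemma sum_UNIV_split_pair:
  fixes f :: "'n::finite \<Rightarrow> 'a::comm_monoid_add"
  assumes "i \<noteq> j"
  shows "(\<Sum>k\<in>UNIV. f k) = f i + (f j + (\<Sum>k\<in>UNIV - {i, j}. f k))"
proof -
  have "UNIV = insert i (insert j (UNIV - {i, j}))" by auto
  then show ?thesis using assms
    by (metis (no_types, lifting) DiffD2 finite finite_insert insert_iff sum.insert)
qed

lemma block_unitary_mult_vec:
  assumes "i \<noteq> j"
  shows "(block_unitary i j a b c d *v v) $ p =
    (if p = i then a * v$i + b * v$j else if p = j then c * v$i + d * v$j else v$p)"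
  using assms
  by (auto simp: block_unitary_def matrix_vector_mult_def sum_UNIV_split_pair[OF assms]
      if_distrib[of "\<lambda>x. x * _"] cong: if_cong)

text \<open>The three equations say that the columns of the block are orthonormal. Only one of the
  two products has to be computed, since a left inverse of a square matrix is also a right
  inverse.\<close>

lemma unitary_block_unitary:
  assumes "i \<noteq> j"
    and "cnj a * a + cnj c * c = 1" "cnj b * b + cnj d * d = 1" "cnj a * b + cnj c * d = 0"
  shows "unitary_matrix (block_unitary i j a b c d)" (is "unitary_matrix ?U")
proof -
  \<comment> \<open>Conjugating the orthogonality relation yields the entry of the product at the
    transposed position.\<close>
  have "cnj (cnj a * b + cnj c * d) = 0" using assms(4) by simp
  then have *: "cnj b * a + cnj d * c = 0" by (simp add: mult.commute)
  have "conj_transpose ?U ** ?U = mat 1"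
    using assms *
    by (auto simp: vec_eq_iff conj_transpose_def matrix_matrix_mult_def mat_def block_unitary_def
        sum_UNIV_split_pair[OF assms(1)] if_distrib[of cnj] if_distrib[of "\<lambda>x. x * _"]
        if_distrib[of "\<lambda>x. _ * x"] sum.delta cong: if_cong)
  then show ?thesis
    unfolding unitary_matrix_def using matrix_left_right_inverse by blast
qed

section \<open>Integration against a Haar measure on the sphere\<close>

lemma space_haar_sphere:
  fixes \<mu> :: "(complex^'n) measure"
  assumes "haar_sphere \<mu>"
  shows "space \<mu> = sphere 0 1"
proof -
  have "sets \<mu> = sets sphere_borel" using assms by (simp add: haar_sphere_def)
  from sets_eq_imp_space_eq[OF this] show ?thesis
    by (simp add: space_restrict_space)
qed

lemma measurable_haar_sphere:
  fixes \<mu> :: "(complex^'n) measure"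
  assumes "haar_sphere \<mu>" and "f \<in> borel \<rightarrow>\<^sub>M N"
  shows "f \<in> \<mu> \<rightarrow>\<^sub>M N"
proof -
  have "sets \<mu> = sets sphere_borel" using assms by (simp add: haar_sphere_def)
  then show ?thesis
    using measurable_restrict_space1[OF assms(2)] by (simp cong: measurable_cong_sets)
qed

text \<open>A continuous function is bounded on the compact sphere, which carries all the mass of
  the probability measure.\<close>

lemma integrable_haar_sphere:
  fixes \<mu> :: "(complex^'n) measure" and f :: "complex^'n \<Rightarrow> real"
  assumes "haar_sphere \<mu>" and "continuous_on UNIV f"
  shows "integrable \<mu> f"
proof -
  interpret prob_space \<mu> using assms by (simp add: haar_sphere_def)
  have "compact (f ` sphere 0 1)"
    using assms(2) by (intro compact_continuous_image compact_sphere) (auto intro: continuous_on_subset)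
  then have "bounded (f ` sphere 0 1)" by (rule compact_imp_bounded)
  then obtain B where B: "\<And>c. c \<in> sphere 0 1 \<Longrightarrow> norm (f c) \<le> B"
    unfolding bounded_iff by blast
  show ?thesis
  proof (rule integrable_const_bound)
    show "AE c in \<mu>. norm (f c) \<le> B"
      using B by (auto simp: space_haar_sphere[OF assms(1)])
    show "f \<in> borel_measurable \<mu>"
      by (rule measurable_haar_sphere[OF assms(1) borel_measurable_continuous_onI[OF assms(2)]])
  qed
qed

lemma integral_haar_sphere_unitary:
  fixes \<mu> :: "(complex^'n) measure" and f :: "complex^'n \<Rightarrow> real"
  assumes \<mu>: "haar_sphere \<mu>" and U: "unitary_matrix U" and f: "continuous_on UNIV f"
  shows "(\<integral>c. f (U *v c) \<partial>\<mu>) = (\<integral>c. f c \<partial>\<mu>)"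
proof -
  have sets: "sets \<mu> = sets sphere_borel" and inv: "distr \<mu> \<mu> (\<lambda>c. U *v c) = \<mu>"
    using \<mu> U by (auto simp: haar_sphere_def)
  have "(\<lambda>c. U *v c) \<in> borel_measurable borel"
    unfolding matrix_vector_mult_def
    by (intro borel_measurable_continuous_onI continuous_intros)
  then have "(\<lambda>c. U *v c) \<in> \<mu> \<rightarrow>\<^sub>M sphere_borel"
    by (intro measurable_restrict_space2 measurable_haar_sphere[OF \<mu>])
      (auto simp: space_haar_sphere[OF \<mu>] norm_unitary[OF U])
  then have "(\<lambda>c. U *v c) \<in> \<mu> \<rightarrow>\<^sub>M \<mu>"
    using sets by (simp cong: measurable_cong_sets)
  moreover have "f \<in> borel_measurable \<mu>"
    by (rule measurable_haar_sphere[OF \<mu> borel_measurable_continuous_onI[OF f]])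
  ultimately show ?thesis
    using integral_distr[of "\<lambda>c. U *v c" \<mu> \<mu> f] by (simp add: inv)
qed

text \<open>Inserting the factor 1, the squared norm of a point of the sphere, ties a moment to
  moments of higher degree.\<close>

lemma integral_haar_sphere_sum:
  fixes \<mu> :: "(complex^'n) measure" and f :: "complex^'n \<Rightarrow> real"
  assumes \<mu>: "haar_sphere \<mu>" and f: "continuous_on UNIV f"
  shows "(\<integral>c. f c \<partial>\<mu>) = (\<Sum>k\<in>UNIV. \<integral>c. (cmod (c$k))\<^sup>2 * f c \<partial>\<mu>)"
proof -
  have "f c = (\<Sum>k\<in>UNIV. (cmod (c$k))\<^sup>2 * f c)" if "c \<in> space \<mu>" for c
  proof -
    have "norm c = 1" using that by (simp add: space_haar_sphere[OF \<mu>])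
    then have "(\<Sum>k\<in>UNIV. (cmod (c$k))\<^sup>2) = 1"
      by (simp add: norm_vec_def L2_set_def)
    then show ?thesis by (simp flip: sum_distrib_right)
  qed
  then have "(\<integral>c. f c \<partial>\<mu>) = (\<integral>c. (\<Sum>k\<in>UNIV. (cmod (c$k))\<^sup>2 * f c) \<partial>\<mu>)"
    by (intro Bochner_Integration.integral_cong) auto
  also have "\<dots> = (\<Sum>k\<in>UNIV. \<integral>c. (cmod (c$k))\<^sup>2 * f c \<partial>\<mu>)"
    by (intro Bochner_Integration.integral_sum integrable_haar_sphere[OF \<mu>] continuous_intros f)
  finally show ?thesis .
qed

section \<open>Fourth powers of one coordinate from mixing two\<close>

text \<open>Here |a + wb|^2 is |a|^2 + |b|^2 plus a cross term linear in w and its conjugate. Over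
  the fourth roots of unity the cross term averages to 0 and its square to 2 |a|^2 |b|^2; the signs
  1 and -1 alone would leave the terms in w^2.\<close>

lemma sum_phases_cmod_power4:
  "cmod (a + b)^4 + cmod (a - b)^4 + cmod (a + \<i> * b)^4 + cmod (a - \<i> * b)^4
    = 4 * (cmod a)^4 + 4 * (cmod b)^4 + 16 * ((cmod a)\<^sup>2 * (cmod b)\<^sup>2)"
proof -
  have "cmod z ^ 4 = ((Re z)\<^sup>2 + (Im z)\<^sup>2)\<^sup>2" for z
    by (simp flip: cmod_power2)
  then show ?thesis
    by (simp add: cmod_power2) (simp add: power2_eq_square algebra_simps)
qed

lemma integral_haar_sphere_square:
  fixes \<mu> :: "(complex^'n) measure" and f :: "complex^'n \<Rightarrow> real"
  assumes \<mu>: "haar_sphere \<mu>" and ij: "i \<noteq> j" and f: "continuous_on UNIV f"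
    and indep: "\<And>c d. (\<And>k. k \<noteq> i \<Longrightarrow> k \<noteq> j \<Longrightarrow> c$k = d$k) \<Longrightarrow> f c = f d"
  shows "(\<integral>c. (cmod (c$i))^4 * f c \<partial>\<mu>) = 2 * (\<integral>c. (cmod (c$i))\<^sup>2 * (cmod (c$j))\<^sup>2 * f c \<partial>\<mu>)"
proof -
  note int_add = Bochner_Integration.integral_add[OF integrable_haar_sphere[OF \<mu>] integrable_haar_sphere[OF \<mu>]]
  define s where "s = complex_of_real (1 / sqrt 2)"
  have ss: "s * s = 1/2" "cnj s = s"
    by (simp_all add: s_def flip: of_real_mult)
  have s4: "cmod s ^ 4 = 1/4"
    by (simp add: s_def norm_divide power_divide power4_eq_xxxx)
  define U where "U w = block_unitary i j s (s * w) s (- s * w)" for w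
  have U: "unitary_matrix (U w)" if "cnj w * w = 1" for w
    unfolding U_def
  proof (rule unitary_block_unitary[OF ij])
    have "cnj (s * w) * (s * w) + cnj (- s * w) * (- s * w) = 2 * (s * s) * (cnj w * w)"
      by (simp add: ss)
    then show "cnj (s * w) * (s * w) + cnj (- s * w) * (- s * w) = 1"
      using that by (simp add: ss)
  qed (simp_all add: ss)
  have fU: "f (U w *v c) = f c" for w c
    by (rule indep) (simp add: U_def block_unitary_mult_vec[OF ij])
  have Ui: "(U w *v c) $ i = s * (c$i + w * c$j)" and Uj: "(U w *v c) $ j = s * (c$i - w * c$j)" for w c
    using ij by (simp_all add: U_def block_unitary_mult_vec[OF ij] algebra_simps)
  define A where "A k = (\<integral>c. (cmod (c$k))^4 * f c \<partial>\<mu>)" for k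
  define B where "B = (\<integral>c. (cmod (c$i))\<^sup>2 * (cmod (c$j))\<^sup>2 * f c \<partial>\<mu>)"
  \<comment> \<open>Invariance under \<open>U w\<close> does not affect \<open>f\<close>, and the
    factor 4 undoes \<open>cmod s ^ 4 = 1/4\<close>.\<close>
  have Ai: "(\<integral>c. (cmod (c$i + w * c$j))^4 * f c \<partial>\<mu>) = 4 * A i"
    and Aj: "(\<integral>c. (cmod (c$i - w * c$j))^4 * f c \<partial>\<mu>) = 4 * A j" if "cnj w * w = 1" for w
  proof -
    have "A k = (\<integral>c. (cmod ((U w *v c)$k))^4 * f (U w *v c) \<partial>\<mu>)" for k
      unfolding A_def
      by (rule integral_haar_sphere_unitary[OF \<mu> U[OF that], symmetric]) (intro continuous_intros f)
    then show "(\<integral>c. (cmod (c$i + w * c$j))^4 * f c \<partial>\<mu>) = 4 * A i"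
      "(\<integral>c. (cmod (c$i - w * c$j))^4 * f c \<partial>\<mu>) = 4 * A j"
      by (simp_all add: fU Ui Uj norm_mult power_mult_distrib s4)
  qed
  \<comment> \<open>Row i for w = 1 and row j for w = -1 both produce the sum of the two
    coordinates.\<close>
  have swap: "A i = A j"
    using Ai[of 1] Aj[of "-1"] by simp
  \<comment> \<open>Row j supplies the phases -1 and -\<open>\<i>\<close>, so each of the four
    integrals equals \<open>4 * A i\<close>.\<close>
  have "16 * A i = (\<integral>c. (cmod (c$i + c$j))^4 * f c \<partial>\<mu>) + (\<integral>c. (cmod (c$i - c$j))^4 * f c \<partial>\<mu>)
      + (\<integral>c. (cmod (c$i + \<i> * c$j))^4 * f c \<partial>\<mu>) + (\<integral>c. (cmod (c$i - \<i> * c$j))^4 * f c \<partial>\<mu>)"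
    using Ai[of 1] Ai[of \<i>] Aj[of 1] Aj[of \<i>] swap by simp
  also have "\<dots> = (\<integral>c. (cmod (c$i + c$j))^4 * f c + (cmod (c$i - c$j))^4 * f c
      + (cmod (c$i + \<i> * c$j))^4 * f c + (cmod (c$i - \<i> * c$j))^4 * f c \<partial>\<mu>)"
    by (simp add: int_add f continuous_intros)
  also have "\<dots> = (\<integral>c. 4 * ((cmod (c$i))^4 * f c) + 4 * ((cmod (c$j))^4 * f c)
      + 16 * ((cmod (c$i))\<^sup>2 * (cmod (c$j))\<^sup>2 * f c) \<partial>\<mu>)"
    by (simp add: sum_phases_cmod_power4 flip: distrib_right) (simp add: algebra_simps)
  also have "\<dots> = 4 * A i + 4 * A j + 16 * B"
    by (simp add: int_add A_def B_def f continuous_intros)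
  \<comment> \<open>With \<open>A i = A j\<close> the chain reads
    \<open>16 * A i = 8 * A i + 16 * B\<close>.\<close>
  finally show ?thesis
    using swap by (simp add: A_def B_def)
qed

section \<open>Solving for the moments of degree four\<close>

lemma integral_haar_sphere_quartic:
  fixes \<mu> :: "(complex^4) measure"
  assumes \<mu>: "haar_sphere \<mu>" and ij: "i \<noteq> j"
  shows "(\<integral>c. (cmod (c$i))^4 * (cmod (c$j))^4 \<partial>\<mu>) = 1 / 210"
proof -
  interpret prob_space \<mu> using \<mu> by (simp add: haar_sphere_def)
  define x where "x k c = (cmod (c$k))\<^sup>2" for k :: 4 and c :: "complex^4"
  have x4: "(cmod (c$k))^4 = x k c * x k c" for k c
    by (simp add: x_def flip: power_add)
  have cx: "continuous_on UNIV (x k)" for k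
    unfolding x_def by (intro continuous_intros)
  define m where "m a = (\<integral>c. x a c \<partial>\<mu>)" for a
  define p where "p a b = (\<integral>c. x a c * x b c \<partial>\<mu>)" for a b
  define t where "t a b c = (\<integral>v. x a v * x b v * x c v \<partial>\<mu>)" for a b c
  \<comment> \<open>The last two factors are bracketed so that they can play the role of
    \<open>f\<close> in \<open>sq\<close>.\<close>
  define q where "q a b c d = (\<integral>v. x a v * x b v * (x c v * x d v) \<partial>\<mu>)" for a b c d
  \<comment> \<open>Adjacent transpositions generate all permutations, so rewriting brings the
    indices into a normal order.\<close>
  have p_comm: "p a b = p b a"
    and t_comm: "t a b c = t b a c" "t a b c = t a c b"
    and q_comm: "q a b c d = q b a c d" "q a b c d = q a c b d" "q a b c d = q a b d c" for a b c d
    unfolding p_def t_def q_def by (simp_all add: mult_ac)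
  have sq: "(\<integral>c. x a c * x a c * f c \<partial>\<mu>) = 2 * (\<integral>c. x a c * x b c * f c \<partial>\<mu>)"
    if "a \<noteq> b" "continuous_on UNIV f"
      "\<And>c d. (\<And>k. k \<noteq> a \<Longrightarrow> k \<noteq> b \<Longrightarrow> c$k = d$k) \<Longrightarrow> f c = f d" for a b f
    using integral_haar_sphere_square[OF \<mu> that] by (simp flip: x4) (simp add: x_def)
  have p_sq: "p a a = 2 * p a b" if "a \<noteq> b" for a b
    using sq[OF that, of "\<lambda>_. 1"] by (simp add: p_def)
  have t_sq: "t a a c = 2 * t a b c" if "a \<noteq> b" "c \<noteq> a" "c \<noteq> b" for a b c
    using that unfolding t_def by (intro sq cx) (auto simp: x_def)
  have q_sq: "q a a c d = 2 * q a b c d" if "a \<noteq> b" "c \<noteq> a" "c \<noteq> b" "d \<noteq> a" "d \<noteq> b" for a b c d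
    using that unfolding q_def by (intro sq continuous_intros cx) (auto simp: x_def)
  have UNIV_eq: "(UNIV :: 4 set) = {a, b, c, d}" if "distinct [a, b, c, d]" for a b c d
    using that by (intro card_subset_eq[symmetric]) auto
  have sum: "(\<integral>c. f c \<partial>\<mu>) = (\<integral>c. x a c * f c \<partial>\<mu>) + (\<integral>c. x b c * f c \<partial>\<mu>)
      + (\<integral>c. x c' c * f c \<partial>\<mu>) + (\<integral>c. x d c * f c \<partial>\<mu>)"
    if "distinct [a, b, c', d]" "continuous_on UNIV f" for a b c' d f
    using integral_haar_sphere_sum[OF \<mu> that(2)] that(1)
    unfolding UNIV_eq[OF that(1)] by (simp add: x_def add.assoc)
  \<comment> \<open>Three of the four terms repeat an index and count twice: 2 + 2 + 2 + 1 =
    7.\<close>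
  have t_eq: "t a b c = 7 * q a b c d" if "distinct [a, b, c, d]" for a b c d
  proof -
    have "t a b c = q a a b c + q b a b c + q c a b c + q d a b c"
      unfolding t_def q_def
      by (subst sum[OF that]) (intro continuous_intros cx, simp add: mult.assoc)
    moreover have "q a a b c = 2 * q a d b c" "q b b a c = 2 * q b d a c" "q c c a b = 2 * q c d a b"
      using that by (auto intro!: q_sq)
    ultimately show ?thesis by (simp add: q_comm)
  qed
  \<comment> \<open>Two terms repeat an index: 7 * (2 + 2 + 1 + 1) = 42.\<close>
  have p_eq: "p a b = 42 * q a b c d" if "distinct [a, b, c, d]" for a b c d
  proof -
    have "p a b = t a a b + t b a b + t c a b + t d a b"
      unfolding p_def t_def
      by (subst sum[OF that]) (intro continuous_intros cx, simp add: mult.assoc)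
    moreover have "t a a b = 2 * t a c b" "t b b a = 2 * t b c a"
      using that by (auto intro!: t_sq)
    moreover have "t a b c = 7 * q a b c d" "t a b d = 7 * q a b d c"
      using that by (auto intro!: t_eq)
    ultimately show ?thesis by (simp add: q_comm t_comm)
  qed
  \<comment> \<open>One term repeats the index: 42 * (2 + 1 + 1 + 1) = 210.\<close>
  have m_eq: "m a = 210 * q a b c d" if "distinct [a, b, c, d]" for a b c d
  proof -
    have "m a = p a a + p b a + p c a + p d a"
      unfolding m_def p_def
      using sum[OF that, of "x a"] by (simp add: cx)
    moreover have "p a a = 2 * p a b"
      using that by (auto intro!: p_sq)
    moreover have "p a b = 42 * q a b c d" "p a c = 42 * q a c b d" "p a d = 42 * q a d b c"
      using that by (auto intro!: p_eq)
    ultimately show ?thesis by (simp add: q_comm p_comm)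
  qed
  have "card (UNIV - {i, j}) = 2" using ij by (simp add: card_Diff_subset)
  then obtain k l where "UNIV - {i, j} = {k, l}" "k \<noteq> l" by (auto simp: card_2_iff)
  then have dist: "distinct [i, j, k, l]" using ij by auto
  have "1 = m i + m j + m k + m l"
    unfolding m_def using sum[OF dist, of "\<lambda>_. 1"] by (simp add: prob_space)
  moreover have "m i = 210 * q i j k l" "m j = 210 * q j i k l" "m k = 210 * q k i j l"
    "m l = 210 * q l i j k"
    using dist by (auto intro!: m_eq)
  ultimately have "840 * q i j k l = 1" by (simp add: q_comm)
  \<comment> \<open>The squares are split one at a time, each with an index not yet present: i with
    k, then j with l. This gives 4 times the product moment, 4/840.\<close>
  moreover have "q i i j j = 2 * q i k j j" "q j j i k = 2 * q j l i k"
    using dist by (auto intro!: q_sq)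
  ultimately have "q i i j j = 1 / 210" by (simp add: q_comm)
  then show ?thesis by (simp add: q_def x4)
qed

theorem mainTheorem6:
  fixes \<mu> :: "(complex^4) measure"
  assumes "haar_sphere \<mu>"
  shows "(\<integral>c. success_prob c \<partial>\<mu>) = 2 / 105"
proof -
  note int = integrable_haar_sphere[OF assms]
  define g where "g c = Re ((c$1)^2 * (c$4)^2 * (cnj (c$2))^2 * (cnj (c$3))^2)" for c :: "complex^4"
  have g: "continuous_on UNIV g"
    unfolding g_def by (intro continuous_intros)
  \<comment> \<open>This is diagonal: it multiplies coordinate 1 by \<open>\<i>\<close> and fixes
    the others, so the square of coordinate 1 changes sign. Coordinate 2 only completes the
    block.\<close>
  define V :: "complex^4^4" where "V = block_unitary 1 2 \<i> 0 0 1"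
  have V: "unitary_matrix V"
    unfolding V_def by (rule unitary_block_unitary) simp_all
  have "g (V *v c) = - g c" for c
    by (simp add: V_def block_unitary_mult_vec g_def power_mult_distrib)
  then have g0: "(\<integral>c. g c \<partial>\<mu>) = 0"
    using integral_haar_sphere_unitary[OF assms V g] by simp
  have "(\<integral>c. success_prob c \<partial>\<mu>) = (\<integral>c. 2 * ((cmod (c$2))^4 * (cmod (c$3))^4)
      + 2 * ((cmod (c$1))^4 * (cmod (c$4))^4) - 4 * g c \<partial>\<mu>)"
    by (simp add: success_prob_def g_def norm_mult norm_power)
  also have "\<dots> = 2 * (\<integral>c. (cmod (c$2))^4 * (cmod (c$3))^4 \<partial>\<mu>)
      + 2 * (\<integral>c. (cmod (c$1))^4 * (cmod (c$4))^4 \<partial>\<mu>) - 4 * (\<integral>c. g c \<partial>\<mu>)"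
    by (simp add: Bochner_Integration.integral_add[OF int int] Bochner_Integration.integral_diff[OF int int]
        g continuous_intros)
  \<comment> \<open>The two moments contribute 2/210 each.\<close>
  finally show ?thesis
    by (simp add: integral_haar_sphere_quartic[OF assms] g0)
qed

end
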